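(* Let $P$ be a Riordan production matrix and let $\zeta(z)$ and $\alpha(z)$ be the generating functions of its columns $0$ and $1$, respectively. Then the bivariate generating function $G_P(t,z)$ of the ECO matrix $A_P$ induced by $P$ and the generating function $f_P(z)$ of the sequence induced by $P$ are given by $$G_P(t,z)=\frac{d(z)}{1-tzh(z)},\qquad f_P(z)=\frac{d(z)}{1-zh(z)},$$ where the formal power series $h(z)$ is determined from the equation $$h(z)=\alpha(zh(z))$$ and $d(z)$ is given by $$d(z)=\frac{1}{1-z\zeta(zh(z))}.$$
   Context: Rows and columns are indexed by nonnegative integers. A production matrix $P=(p_{i,j})$ is a square (possibly infinite) matrix of nonnegative integers, each of whose row sums is a finite positive integer; in particular each row has finitely many nonzero entries, so powers of $P$ and the products $P^n e$ are well defined. A Riordan production matrix is an infinite production matrix of the form $$P=\begin{pmatrix} \zeta_0 & \alpha_0 & 0 & 0 & \cdots\\ \zeta_1 & \alpha_1 & \alpha_0 & 0 & \cdots\\ \zeta_2 & \alpha_2 & \alpha_1 & \alpha_0 & \cdots\\ \vdots & \vdots & \vdots & \vdots & \ddots \end{pmatrix},$$ i.e. $p_{i,0}=\zeta_i$ for $i\ge 0$, $p_{i,j}=\alpha_{i-j+1}$ for $1\leq j\leq i+1$, and $p_{i,j}=0$ for $j>i+1$. Thus $\zeta(z)=\sum_{n\ge0}\zeta_nz^n$ and $\alpha(z)=\sum_{n\geq 0}\alpha_nz^n$. Let $u^\top=(1,0,0,\ldots)$ and let $e$ be the column vector with all entries $1$. The ECO matrix $A_P=(d_{n,k})_{n,k\ge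 0}$ induced by $P$ is the matrix whose $n$-th row is $u^\top P^n$, and its bivariate generating function is $G_P(t,z)=\sum_{n,k\ge0}d_{n,k}t^kz^n$. The sequence induced by $P$ is $a_n=u^\top P^ne$ ($n\geq 0$), i.e. the sequence of row sums of $A_P$, and $f_P(z)=\sum_{n\ge 0}a_nz^n$. All identities are between formal power series. *)

theory Defs
  imports "HOL-Computational_Algebra.Formal_Power_Series"
begin

text \<open>
  Infinite matrices are functions \<^typ>\<open>nat \<Rightarrow> nat \<Rightarrow> nat\<close>, rows first. All products below are
  intended for row-finite left factors: a sum over an infinite support evaluates to 0.
\<close>

definition vec_dot :: "(nat \<Rightarrow> nat) \<Rightarrow> (nat \<Rightarrow> nat) \<Rightarrow> nat" where
  "vec_dot u v = (\<Sum>i | u i \<noteq> 0. u i * v i)"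

definition vec_mat :: "(nat \<Rightarrow> nat) \<Rightarrow> (nat \<Rightarrow> nat \<Rightarrow> nat) \<Rightarrow> nat \<Rightarrow> nat" where
  "vec_mat u A j = vec_dot u (\<lambda>i. A i j)"

definition mat_mult :: "(nat \<Rightarrow> nat \<Rightarrow> nat) \<Rightarrow> (nat \<Rightarrow> nat \<Rightarrow> nat) \<Rightarrow> nat \<Rightarrow> nat \<Rightarrow> nat" where
  "mat_mult A B i j = vec_dot (A i) (\<lambda>k. B k j)"

primrec mat_pow :: "(nat \<Rightarrow> nat \<Rightarrow> nat) \<Rightarrow> nat \<Rightarrow> nat \<Rightarrow> nat \<Rightarrow> nat" where
  "mat_pow A 0 = (\<lambda>i j. if i = j then 1 else 0)"
| "mat_pow A (Suc n) = mat_mult (mat_pow A n) A"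

definition unit_vec :: "nat \<Rightarrow> nat" where
  "unit_vec i = (if i = 0 then 1 else 0)"

definition ones_vec :: "nat \<Rightarrow> nat" where
  "ones_vec i = 1"

definition production_matrix :: "(nat \<Rightarrow> nat \<Rightarrow> nat) \<Rightarrow> bool" where
  "production_matrix P \<longleftrightarrow>
     (\<forall>i. finite {j. P i j \<noteq> 0} \<and> (\<Sum>j | P i j \<noteq> 0. P i j) > 0)"

definition riordan_production_matrix :: "(nat \<Rightarrow> nat \<Rightarrow> nat) \<Rightarrow> bool" where
  "riordan_production_matrix P \<longleftrightarrow>
     production_matrix P \<and>
     (\<exists>\<zeta> \<alpha> :: nat \<Rightarrow> nat. \<forall>i.
        P i 0 = \<zeta> i \<and>
        (\<forall>j. 1 \<le> j \<and> j \<le> i + 1 \<longrightarrow> P i j = \<alpha> (i + 1 - j)) \<and>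
        (\<forall>j. j > i + 1 \<longrightarrow> P i j = 0))"

definition eco_matrix :: "(nat \<Rightarrow> nat \<Rightarrow> nat) \<Rightarrow> nat \<Rightarrow> nat \<Rightarrow> nat" where
  "eco_matrix P n = vec_mat unit_vec (mat_pow P n)"

definition induced_seq :: "(nat \<Rightarrow> nat \<Rightarrow> nat) \<Rightarrow> nat \<Rightarrow> nat" where
  "induced_seq P n = vec_dot (vec_mat unit_vec (mat_pow P n)) ones_vec"

text \<open>
  Generating functions have rational coefficients so that the library's division of formal power
  series is available.
\<close>

definition column_gf :: "(nat \<Rightarrow> nat \<Rightarrow> nat) \<Rightarrow> nat \<Rightarrow> rat fps" where
  "column_gf P j = Abs_fps (\<lambda>i. of_nat (P i j))"

definition induced_gf :: "(nat \<Rightarrow> nat \<Rightarrow> nat) \<Rightarrow> rat fps" where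
  "induced_gf P = Abs_fps (\<lambda>n. of_nat (induced_seq P n))"

text \<open>
  Bivariate series are represented as series in $t$ (outer variable) whose coefficients are series
  in $z$ (inner variable). Hence $t$ is \<^term>\<open>fps_X :: rat fps fps\<close>, and a series \<^term>\<open>g :: rat fps\<close>
  in $z$ alone embeds as \<^term>\<open>fps_const g\<close>.
\<close>

definition eco_gf :: "(nat \<Rightarrow> nat \<Rightarrow> nat) \<Rightarrow> rat fps fps" where
  "eco_gf P = Abs_fps (\<lambda>k. Abs_fps (\<lambda>n. of_nat (eco_matrix P n k)))"

text \<open>
  The coefficient ring of \<^typ>\<open>rat fps fps\<close> is not a field, but division by a series with constant
  coefficient 1 is still genuine division.
\<close>

lemma bivariate_divide_mult_cancel:
  fixes f g :: "rat fps fps"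
  assumes "fps_nth g 0 = 1"
  shows "f / g * g = f"
proof -
  have "f / g = f * inverse g"
    by (rule fps_divide_unit) (simp add: assms)
  moreover have "g * inverse g = 1"
    by (subst fps_inverse_def, rule fps_right_inverse) (simp add: assms)
  ultimately show ?thesis
    by (metis mult.assoc mult.commute mult.right_neutral)
qed

end

theory Submission
  imports Defs
begin

text \<open>
  Write $b = z h$. The whole statement reduces to one fact: column $k$ of the ECO matrix has
  generating function $C_k(z) = d(z)\, b(z)^k$, that is, the ECO matrix is the Riordan array
  of the pair $(d, b)$.

  Reading off $u^\top P^{n+1} = (u^\top P^n) P$ column by column, the shape of $P$ turns into
  \[ C_0 = 1 + z \sum_i \zeta_i C_i, \qquad
     C_k = z \sum_i \alpha_i C_{k-1+i} \quad (k \ge 1). \]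
  The factor $z$ makes this system determine the coefficients of all $C_k$ recursively in $n$, so
  it suffices that $d\, b^k$ satisfies it too. For geometric columns the sums on the right are
  compositions: $\sum_i \zeta_i d\, b^i = d \cdot \zeta(b)$ and
  $z \sum_i \alpha_i d\, b^{k-1+i} = d\, b^{k-1} \cdot z\,\alpha(b)$. Hence the two equations
  become $d = 1 + z\, d\, \zeta(b)$ and $z\,\alpha(b) = b$, which are the equations
  defining $d$ and $h$. This is \<open>eco_matrix_eq_nth\<close>, with \<open>mult_compose_nth\<close> identifying
  coefficients of such a composition with the finite sums produced by the matrix product.
  Both generating functions are then geometric series, in $t b$ and in $b$.

  The series $h$ exists and is unique because coefficient $n$ of $\alpha(z h)$ involves
  only coefficients of $h$ of index less than $n$: the equation for $h$ is a fixed point equation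
  for a contraction in the $z$-adic sense (\<open>contractive_unique_fixed_point\<close>).
\<close>

unbundle fps_syntax

section \<open>The functional equation for h\<close>

text \<open>
  The Banach fixed point argument in the $z$-adic metric: each application of \<open>F\<close> makes one more
  coefficient correct, so the iterates from \<open>0\<close> stabilise coefficientwise to a fixed point, and
  two fixed points agree by strong induction on the index.
\<close>

lemma contractive_unique_fixed_point:
  fixes F :: "'a::zero fps \<Rightarrow> 'a fps"
  assumes F: "\<And>f g n. (\<And>i. i < n \<Longrightarrow> f $ i = g $ i) \<Longrightarrow> F f $ n = F g $ n"
  shows "\<exists>!h. h = F h"
proof (rule ex_ex1I)
  define H where "H m = (F ^^ m) 0" for m
  have H_Suc: "H (Suc m) = F (H m)" for m
    by (simp add: H_def)
  have step: "H m $ i = H (Suc m) $ i" if "i < m" for m i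
    using that
  proof (induction m arbitrary: i)
    case (Suc m)
    then show ?case
      unfolding H_Suc[of m] H_Suc[of "Suc m"] by (intro F) auto
  qed simp
  have stable: "H m $ i = H (Suc i) $ i" if "i < m" for m i
  proof -
    from that have "Suc i \<le> m" by simp
    then show ?thesis
      by (induction m rule: dec_induct) (simp_all add: step[symmetric])
  qed
  \<comment> \<open>Coefficient \<open>n\<close> of the iterates is final from the iterate \<open>n + 1\<close> onwards.\<close>
  define h where "h = Abs_fps (\<lambda>n. H (Suc n) $ n)"
  have "h $ n = F h $ n" for n
  proof -
    have "h $ n = F (H n) $ n"
      by (simp add: h_def H_Suc)
    also have "\<dots> = F h $ n"
      by (rule F) (simp add: h_def stable[of _ n])
    finally show ?thesis .
  qed
  then show "\<exists>h. h = F h"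
    by (blast intro: fps_ext)
next
  fix g h assume g: "g = F g" and h: "h = F h"
  have "g $ n = h $ n" for n
  proof (induction n rule: less_induct)
    case (less n)
    then have "F g $ n = F h $ n" by (rule F)
    then show ?case unfolding g[symmetric] h[symmetric] .
  qed
  then show "g = h" by (simp add: fps_eq_iff)
qed

lemma fps_power_nth_cong:
  fixes f g :: "'a::comm_semiring_1 fps"
  assumes "\<And>i. i \<le> n \<Longrightarrow> f $ i = g $ i" and "m \<le> n"
  shows "(f ^ k) $ m = (g ^ k) $ m"
  using assms(2)
proof (induction k arbitrary: m)
  case (Suc k)
  then show ?case
    by (auto simp: fps_mult_nth assms(1) intro!: sum.cong)
qed simp

text \<open>
  The factor \<open>fps_X\<close> delays every coefficient of \<open>h\<close> by one place, which is what makes the right-hand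
  side contractive. A zero constant coefficient of \<open>\<alpha>\<close> is covered; the solution is then \<open>0\<close>.
\<close>

lemma compose_fps_X_mult_unique_fixed_point:
  fixes \<alpha> :: "'a::comm_ring_1 fps"
  shows "\<exists>!h. h = \<alpha> oo (fps_X * h)"
proof (rule contractive_unique_fixed_point)
  fix f g :: "'a fps" and n
  assume "\<And>i. i < n \<Longrightarrow> f $ i = g $ i"
  then have "(fps_X * f) $ i = (fps_X * g) $ i" if "i \<le> n" for i
    using that by (cases i) auto
  then have "((fps_X * f) ^ k) $ n = ((fps_X * g) ^ k) $ n" for k
    by (rule fps_power_nth_cong[OF _ order.refl])
  then show "(\<alpha> oo (fps_X * f)) $ n = (\<alpha> oo (fps_X * g)) $ n"
    by (simp add: fps_compose_nth)
qed

section \<open>Coefficients of compositions\<close>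

lemma mult_power_nth_eq_0:
  fixes b c :: "'a::comm_ring_1 fps"
  assumes "b $ 0 = 0" and "n < i"
  shows "(c * b ^ i) $ n = 0"
  using assms by (auto simp: fps_mult_nth startsby_zero_power_prefix intro!: sum.neutral)

text \<open>
  This is $c \cdot a(b) = \sum_i a_i\, c\, b^i$ read at coefficient $n$. Since $b$ has no constant
  term, $c\, b^i$ starts at index $i$ or later, so the infinite sum may be cut off at $n$,
  uniformly in the index at which $b^i$ is evaluated inside the product with $c$.
\<close>

lemma mult_compose_nth:
  fixes a b c :: "'a::comm_ring_1 fps"
  assumes b: "b $ 0 = 0"
  shows "(c * (a oo b)) $ n = (\<Sum>i\<le>n. a $ i * (c * b ^ i) $ n)"
proof -
  have ext: "(a oo b) $ (n - j) = (\<Sum>i\<le>n. a $ i * (b ^ i) $ (n - j))" for j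
    unfolding fps_compose_nth
    by (rule sum.mono_neutral_left) (auto simp: startsby_zero_power_prefix[OF b])
  have "(c * (a oo b)) $ n = (\<Sum>j=0..n. \<Sum>i\<le>n. c $ j * (a $ i * (b ^ i) $ (n - j)))"
    by (simp add: fps_mult_nth ext sum_distrib_left)
  also have "\<dots> = (\<Sum>i\<le>n. \<Sum>j=0..n. c $ j * (a $ i * (b ^ i) $ (n - j)))"
    by (rule sum.swap)
  also have "\<dots> = (\<Sum>i\<le>n. a $ i * (c * b ^ i) $ n)"
    by (simp add: fps_mult_nth sum_distrib_left mult.left_commute)
  finally show ?thesis .
qed

section \<open>The ECO matrix\<close>

lemma vec_dot_eq_sum:
  assumes "\<And>i. i > n \<Longrightarrow> u i = 0"
  shows "vec_dot u v = (\<Sum>i\<le>n. u i * v i)"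
proof -
  have "{i. u i \<noteq> 0} \<subseteq> {..n}"
    using assms by (auto intro: leI)
  then show ?thesis
    unfolding vec_dot_def by (rule sum.mono_neutral_left[OF finite_atMost]) auto
qed

lemma eco_matrix_eq_mat_pow: "eco_matrix P n k = mat_pow P n 0 k"
  unfolding eco_matrix_def vec_mat_def
  by (subst vec_dot_eq_sum[where n = 0]) (auto simp: unit_vec_def)

lemma eco_matrix_0: "eco_matrix P 0 k = (if k = 0 then 1 else 0)"
  by (simp add: eco_matrix_eq_mat_pow)

lemma eco_matrix_Suc_vec_dot: "eco_matrix P (Suc n) k = vec_dot (eco_matrix P n) (\<lambda>i. P i k)"
proof -
  have "eco_matrix P n = mat_pow P n 0"
    by (simp add: fun_eq_iff eco_matrix_eq_mat_pow)
  then show ?thesis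
    by (simp add: eco_matrix_eq_mat_pow mat_mult_def)
qed

text \<open>
  One multiplication by a matrix with a single superdiagonal moves the support of a row vector by at
  most one place, so the ECO matrix is lower triangular. This is what turns the support-indexed
  sums of the matrix products below into sums over \<open>{..n}\<close>.
\<close>

lemma eco_matrix_eq_0:
  assumes hess: "\<And>i j. j > i + 1 \<Longrightarrow> P i j = 0"
  shows "k > n \<Longrightarrow> eco_matrix P n k = 0"
proof (induction n arbitrary: k)
  case 0
  then show ?case by (simp add: eco_matrix_0)
next
  case (Suc n)
  then show ?case
    by (subst eco_matrix_Suc_vec_dot, subst vec_dot_eq_sum[where n = n]) (auto simp: hess)
qed

lemma eco_matrix_Suc:
  assumes hess: "\<And>i j. j > i + 1 \<Longrightarrow> P i j = 0"
  shows "eco_matrix P (Suc n) k = (\<Sum>i\<le>n. eco_matrix P n i * P i k)"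
  unfolding eco_matrix_Suc_vec_dot by (rule vec_dot_eq_sum) (rule eco_matrix_eq_0[OF hess])

lemma induced_seq_eq_sum:
  assumes hess: "\<And>i j. j > i + 1 \<Longrightarrow> P i j = 0"
  shows "induced_seq P n = (\<Sum>k\<le>n. eco_matrix P n k)"
proof -
  have "induced_seq P n = vec_dot (eco_matrix P n) ones_vec"
    by (simp add: induced_seq_def eco_matrix_def)
  also have "\<dots> = (\<Sum>k\<le>n. eco_matrix P n k * ones_vec k)"
    by (rule vec_dot_eq_sum) (rule eco_matrix_eq_0[OF hess])
  finally show ?thesis by (simp add: ones_vec_def)
qed

lemma riordan_production_matrix_hessenberg:
  "riordan_production_matrix P \<Longrightarrow> j > i + 1 \<Longrightarrow> P i j = 0"
  unfolding riordan_production_matrix_def by blast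

text \<open>
  Each later column is column 1 shifted down, so \<open>\<alpha>\<close> can be eliminated in favour of column 1.
\<close>

lemma riordan_production_matrix_entry:
  assumes "riordan_production_matrix P" and "k \<le> i"
  shows "P i (Suc k) = P (i - k) 1"
proof -
  obtain \<alpha> where \<alpha>: "\<And>i j. 1 \<le> j \<Longrightarrow> j \<le> i + 1 \<Longrightarrow> P i j = \<alpha> (i + 1 - j)"
    using assms(1) unfolding riordan_production_matrix_def by blast
  then show ?thesis using \<alpha>[of "Suc k" i] \<alpha>[of 1 "i - k"] assms(2) by simp
qed

text \<open>
  The ECO matrix is the Riordan array of $(d, z h)$. The equation for \<open>d\<close> is the product form of
  $d = 1 / (1 - z \zeta(z h))$. The induction on \<open>n\<close> is simultaneous in all columns \<open>k\<close>, since a row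
  depends on all entries of the row before.
\<close>

lemma eco_matrix_eq_nth:
  fixes h d :: "rat fps"
  assumes P: "riordan_production_matrix P"
    and h: "h = column_gf P 1 oo (fps_X * h)"
    and d: "d = 1 + fps_X * (d * (column_gf P 0 oo (fps_X * h)))"
  shows "of_nat (eco_matrix P n k) = (d * (fps_X * h) ^ k) $ n"
proof (induction n arbitrary: k)
  case 0
  have "d $ 0 = 1" by (subst d) simp
  then show ?case by (cases k) (auto simp: eco_matrix_0)
next
  case (Suc n)
  note hess = riordan_production_matrix_hessenberg[OF P]
  define b where "b = fps_X * h"
  have b0: "b $ 0 = 0" by (simp add: b_def)
  have rec: "of_nat (eco_matrix P (Suc n) k) = (\<Sum>i\<le>n. of_nat (P i k) * (d * b ^ i) $ n)"
    by (simp add: eco_matrix_Suc[OF hess] Suc.IH b_def mult.commute)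
  show ?case
  proof (cases k)
    case 0
    have "d $ Suc n = (d * (column_gf P 0 oo b)) $ n"
      by (subst d) (simp add: b_def)
    then show ?thesis
      using rec 0 by (simp add: mult_compose_nth[OF b0] column_gf_def)
  next
    case (Suc l)
    \<comment> \<open>Of the factors \<open>b = fps_X * h\<close>, a single one is split: its \<open>fps_X\<close> steps back to row \<open>n\<close>,
      and its \<open>h\<close> is replaced by the composition \<open>\<alpha>(b)\<close>.\<close>
    have "(d * b ^ Suc l) $ Suc n = (fps_X * (d * b ^ l * h)) $ Suc n"
      by (simp add: b_def mult_ac)
    also have "\<dots> = (d * b ^ l * (column_gf P 1 oo b)) $ n"
      unfolding b_def h[symmetric] by simp
    also have "\<dots> = (\<Sum>m\<le>n. of_nat (P m 1) * (d * b ^ (l + m)) $ n)"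
      unfolding mult_compose_nth[OF b0] by (simp add: column_gf_def power_add mult.assoc)
    also have "\<dots> = (\<Sum>i\<in>{l..l+n}. of_nat (P i k) * (d * b ^ i) $ n)"
      by (rule sum.reindex_bij_witness[of _ "\<lambda>i. i - l" "\<lambda>m. l + m"])
        (auto simp: Suc riordan_production_matrix_entry[OF P, of l])
    \<comment> \<open>The range \<open>{l..l+n}\<close> is adapted to \<open>{..n}\<close> at both ends: for \<open>i < l\<close> the entry \<open>P i k\<close>
      lies above the superdiagonal, and for \<open>i > n\<close> the series \<open>d * b ^ i\<close> starts after index \<open>n\<close>.\<close>
    also have "\<dots> = (\<Sum>i\<le>l+n. of_nat (P i k) * (d * b ^ i) $ n)"
      by (rule sum.mono_neutral_left) (auto simp: Suc hess)
    also have "\<dots> = (\<Sum>i\<le>n. of_nat (P i k) * (d * b ^ i) $ n)"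
      by (rule sum.mono_neutral_right) (auto simp: mult_power_nth_eq_0[OF b0])
    finally show ?thesis using rec Suc by (simp add: b_def)
  qed
qed

theorem proposition3p2:
  fixes P :: "nat \<Rightarrow> nat \<Rightarrow> nat" and \<zeta> \<alpha> :: "rat fps"
  assumes "riordan_production_matrix P"
    and "\<zeta> = column_gf P 0"
    and "\<alpha> = column_gf P 1"
  shows "(\<exists>!h :: rat fps. h = \<alpha> oo (fps_X * h)) \<and>
    (\<forall>h d :: rat fps.
       h = \<alpha> oo (fps_X * h) \<longrightarrow>
       d = 1 / (1 - fps_X * (\<zeta> oo (fps_X * h))) \<longrightarrow>
       eco_gf P = fps_const d / (1 - fps_X * fps_const (fps_X * h)) \<and>
       induced_gf P = d / (1 - fps_X * h))"
proof (intro conjI allI impI)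
  show "\<exists>!h. h = \<alpha> oo (fps_X * h)"
    by (rule compose_fps_X_mult_unique_fixed_point)
next
  fix h d :: "rat fps"
  assume h: "h = \<alpha> oo (fps_X * h)"
    and d_def: "d = 1 / (1 - fps_X * (\<zeta> oo (fps_X * h)))"
  define b where "b = fps_X * h"
  have b0: "b $ 0 = 0" by (simp add: b_def)
  have "d * (1 - fps_X * (\<zeta> oo b)) = 1"
    unfolding d_def b_def by (simp add: fps_divide_unit inverse_mult_eq_1)
  then have d: "d = 1 + fps_X * (d * (\<zeta> oo (fps_X * h)))"
    by (simp add: b_def algebra_simps)
  have entry: "of_nat (eco_matrix P n k) = (d * b ^ k) $ n" for n k
    unfolding b_def by (rule eco_matrix_eq_nth[OF assms(1) h[unfolded assms(3)] d[unfolded assms(2)]])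
  have col: "eco_gf P $ k = d * b ^ k" for k
    by (simp add: eco_gf_def entry fps_eq_iff)

  \<comment> \<open>As a series in \<open>t\<close>, the coefficients \<open>d * b ^ k\<close> are geometric, so multiplying by
    \<open>1 - t b\<close> telescopes to the coefficient for \<open>k = 0\<close>.\<close>
  let ?g = "1 - fps_X * fps_const b :: rat fps fps"
  have "eco_gf P * ?g = eco_gf P - fps_X * (eco_gf P * fps_const b)"
    by (simp add: algebra_simps)
  then have "(eco_gf P * ?g) $ k = fps_const d $ k" for k
    by (cases k) (simp_all add: col mult.commute mult.left_commute)
  then have "eco_gf P * ?g = fps_const d" by (simp add: fps_eq_iff)
  also have "\<dots> = fps_const d / ?g * ?g"
    by (rule bivariate_divide_mult_cancel[symmetric]) simp
  finally have eq: "eco_gf P * ?g = fps_const d / ?g * ?g" .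
  have "?g $ 0 \<noteq> 0" by simp
  then have "?g \<noteq> 0" by (metis fps_zero_nth)
  with eq show "eco_gf P = fps_const d / (1 - fps_X * fps_const (fps_X * h))"
    unfolding b_def by simp

  \<comment> \<open>Setting \<open>t = 1\<close>: row sums of the coefficients of \<open>d * b ^ k\<close> are the composition of the
    geometric series \<open>E\<close> with \<open>b\<close>.\<close>
  define E where "E = (Abs_fps (\<lambda>_. 1) :: rat fps)"
  have "induced_gf P $ n = (d * (E oo b)) $ n" for n
    using riordan_production_matrix_hessenberg[OF assms(1)]
    by (simp add: induced_gf_def induced_seq_eq_sum entry mult_compose_nth[OF b0] E_def)
  then have "induced_gf P = d * (E oo b)" by (simp add: fps_eq_iff)
  moreover have "(E oo b) * (1 - b) = 1"
  proof -
    have "E * (1 - fps_X) = 1"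
      by (auto simp: fps_eq_iff E_def right_diff_distrib)
    then have "(E * (1 - fps_X)) oo b = 1" by simp
    then show ?thesis
      by (simp add: fps_compose_mult_distrib[OF b0] fps_compose_sub_distrib fps_X_fps_compose_startby0[OF b0])
  qed
  ultimately have "induced_gf P * (1 - b) = d" by (simp add: mult.assoc)
  moreover have "(1 - b) \<noteq> 0" using b0 by (metis diff_zero fps_one_nth fps_sub_nth fps_zero_nth zero_neq_one)
  ultimately show "induced_gf P = d / (1 - fps_X * h)"
    unfolding b_def by (metis nonzero_mult_div_cancel_right)
qed

end
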